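(* The group $E_{6(-14),\mathbb R}=\{\alpha\in \mathrm{Iso}_C(\mathfrak J(3,\mathbb R^C)) \mid \det(\alpha X)=\det X,\ \langle\alpha X,\alpha Y\rangle_\sigma=\langle X,Y\rangle_\sigma \text{ for all } X,Y\in\mathfrak J(3,\mathbb R^C)\}$ is isomorphic to the group $SU(1,2)$.
   Context: $C=\mathbb R\oplus\mathbb R i$ is the field of complex numbers, and $\mathbb R^C=C$. $\mathfrak J(3,\mathbb R^C)$ is the $C$-vector space of symmetric $3\times3$ matrices with entries in $C$; $\det$ is the usual determinant; $(X,Y)=\mathrm{tr}(XY)$ is the $C$-bilinear inner product; $\tau$ is entrywise complex conjugation; $\sigma X=I_1XI_1$ with $I_1=\mathrm{diag}(-1,1,1)$; and $\langle X,Y\rangle_\sigma=(\tau\sigma X,Y)$. $\mathrm{Iso}_C(V)$ is the group of $C$-linear automorphisms of $V$. $SU(1,2)=\{A\in M(3,C)\mid A I_1(\tau\,{}^tA)=I_1,\ \det A=1\}$. *)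

theory Defs
  imports "HOL-Analysis.Analysis" "HOL-Algebra.Bij"
begin

type_synonym cmat3 = "complex^3^3"

definition cscale :: "complex \<Rightarrow> cmat3 \<Rightarrow> cmat3" where
  "cscale c X = map_matrix (\<lambda>z. c * z) X"

definition J3 :: "cmat3 set" where
  "J3 = {X. transpose X = X}"

definition tau :: "cmat3 \<Rightarrow> cmat3" where
  "tau X = map_matrix cnj X"

definition I1 :: cmat3 where
  "I1 = vector [vector [-1, 0, 0],
                vector [ 0, 1, 0],
                vector [ 0, 0, 1]]"

definition sigma :: "cmat3 \<Rightarrow> cmat3" where
  "sigma X = I1 ** X ** I1"

text \<open>The form \<open>bil\<close> is bilinear over the complex numbers; it is not the real inner product
  of the library type.\<close>

definition bil :: "cmat3 \<Rightarrow> cmat3 \<Rightarrow> complex" where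
  "bil X Y = trace (X ** Y)"

definition herm_sigma :: "cmat3 \<Rightarrow> cmat3 \<Rightarrow> complex" where
  "herm_sigma X Y = bil (tau (sigma X)) Y"

text \<open>An automorphism of a complex subspace \<open>V\<close> is represented by its extensional function
  (\<open>undefined\<close> outside \<open>V\<close>), so that equality of group elements is equality of maps on \<open>V\<close>.
  The multiplication inherited from \<^const>\<open>BijGroup\<close> is composition.\<close>

definition Iso_C :: "cmat3 set \<Rightarrow> (cmat3 \<Rightarrow> cmat3) monoid" where
  "Iso_C V = (BijGroup V)
     \<lparr>carrier := {f \<in> carrier (BijGroup V).
        (\<forall>X\<in>V. \<forall>Y\<in>V. f (X + Y) = f X + f Y) \<and>
        (\<forall>c. \<forall>X\<in>V. f (cscale c X) = cscale c (f X))}\<rparr>"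

definition E6_m14_R :: "(cmat3 \<Rightarrow> cmat3) monoid" where
  "E6_m14_R = (Iso_C J3)
     \<lparr>carrier := {\<alpha> \<in> carrier (Iso_C J3).
        (\<forall>X\<in>J3. det (\<alpha> X) = det X) \<and>
        (\<forall>X\<in>J3. \<forall>Y\<in>J3. herm_sigma (\<alpha> X) (\<alpha> Y) = herm_sigma X Y)}\<rparr>"

definition SU_1_2 :: "cmat3 monoid" where
  "SU_1_2 =
     \<lparr>carrier = {A. A ** I1 ** tau (transpose A) = I1 \<and> det A = 1},
      mult = (**),
      one = mat 1\<rparr>"

end

(*
  SU(1,2) acts on symmetric matrices by X |-> A X A^T. A determinant preserver f is of the form
  X |-> P X P^T: it preserves the symmetric matrices of rank at most one, so f(E_i) = w_i w_i^T,
  and after composing with the congruence by [w_1 w_2 w_3]^-1 it fixes each E_i. Then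
  t^2 E_i + E_j + t f(F_ij) has rank one for every t, which forces f(F_ij) = +-F_ij, and the
  determinant of F_12 + F_13 + F_23 shows that these signs come from a diagonal congruence.
  For f preserving the hermitian form, evaluating the form on the matrices E_i and F_ij shows
  that the hermitian matrix P^* I1 P is a multiple of I1, and det P = 1 makes it equal to I1.
*)

theory Submission
  imports Defs "HOL-Algebra.Coset"
begin

section \<open>Symmetric complex 3x3 matrices and congruence\<close>

lemmas mat3_simps = matrix_matrix_mult_def transpose_def sum_3 forall_3 vec_eq_iff

lemma cscale_nth [simp]: "cscale c X $ i $ j = c * X $ i $ j"
  by (simp add: cscale_def)

lemma det_cscale: "det (cscale c X) = c ^ 3 * det X"
  by (simp add: det_3 power3_eq_cube algebra_simps)

lemma J3_iff: "X \<in> J3 \<longleftrightarrow> (\<forall>i j. X $ i $ j = X $ j $ i)"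
  by (auto simp: J3_def transpose_def vec_eq_iff)

lemma J3_sym: "X \<in> J3 \<Longrightarrow> X $ i $ j = X $ j $ i"
  by (simp add: J3_iff)

lemma J3_add: "X \<in> J3 \<Longrightarrow> Y \<in> J3 \<Longrightarrow> X + Y \<in> J3"
  by (simp add: J3_iff)

lemma J3_cscale: "X \<in> J3 \<Longrightarrow> cscale c X \<in> J3"
  by (simp add: J3_iff)

lemma J3_congruence: "X \<in> J3 \<Longrightarrow> P ** X ** transpose P \<in> J3"
  by (simp add: J3_def matrix_transpose_mul matrix_mul_assoc)

text \<open>The hypothesis is on the square because congruence by \<open>P\<close> multiplies
  determinants by \<open>det P ^ 2\<close>; the sign of \<open>det P\<close> stays open until the
  very end.\<close>

lemma det_eq_1_imp_invertible:
  fixes P :: cmat3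
  assumes "det P ^ 2 = 1"
  obtains Q where "Q ** P = mat 1" "P ** Q = mat 1" "det Q ^ 2 = 1"
proof -
  have "det P \<noteq> 0" using assms by auto
  then obtain Q where Q: "Q ** P = mat 1" "P ** Q = mat 1"
    by (meson invertible_det_nz invertible_def)
  have "det Q * det P = 1"
    by (metis Q(1) det_mul det_I)
  then have "det Q ^ 2 * det P ^ 2 = 1"
    by (metis power_mult_distrib one_power2)
  then show ?thesis using that Q assms by simp
qed

section \<open>Linear bijections of \<open>J3\<close> that preserve the determinant\<close>

text \<open>Values outside \<open>J3\<close> are left free, so that congruences and their
  compositions qualify as plain functions; \<open>det_preserver_cong\<close> passes to the
  extensional representatives.\<close>

definition det_preserver :: "(cmat3 \<Rightarrow> cmat3) \<Rightarrow> bool" where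
  "det_preserver f \<longleftrightarrow> bij_betw f J3 J3 \<and>
     (\<forall>X\<in>J3. \<forall>Y\<in>J3. f (X + Y) = f X + f Y) \<and>
     (\<forall>c. \<forall>X\<in>J3. f (cscale c X) = cscale c (f X)) \<and>
     (\<forall>X\<in>J3. det (f X) = det X)"

lemma det_preserverD:
  assumes "det_preserver f"
  shows "bij_betw f J3 J3"
    and "X \<in> J3 \<Longrightarrow> f X \<in> J3"
    and "X \<in> J3 \<Longrightarrow> Y \<in> J3 \<Longrightarrow> f (X + Y) = f X + f Y"
    and "X \<in> J3 \<Longrightarrow> f (cscale c X) = cscale c (f X)"
    and "X \<in> J3 \<Longrightarrow> det (f X) = det X"
  using assms by (auto simp: det_preserver_def bij_betw_apply)

lemma det_preserver_comp:
  assumes "det_preserver f" "det_preserver g"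
  shows "det_preserver (\<lambda>X. f (g X))"
  using assms bij_betw_trans[of g J3 J3 f J3]
  by (auto simp: det_preserver_def bij_betw_apply o_def)

lemma det_preserver_cong:
  assumes "\<And>X. X \<in> J3 \<Longrightarrow> f X = g X"
  shows "det_preserver f \<longleftrightarrow> det_preserver g"
  using assms by (simp add: det_preserver_def J3_add J3_cscale cong: bij_betw_cong)

lemma det_preserver_inv_into:
  assumes "det_preserver f"
  shows "det_preserver (inv_into J3 f)"
proof -
  note f = det_preserverD[OF assms]
  let ?g = "inv_into J3 f"
  have g: "bij_betw ?g J3 J3" by (rule bij_betw_inv_into[OF f(1)])
  then have gJ: "?g X \<in> J3" if "X \<in> J3" for X using that by (rule bij_betw_apply)
  have fg: "f (?g X) = X" if "X \<in> J3" for X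
    using f(1) that by (rule bij_betw_inv_into_right)
  have eqI: "?g X = Z" if "Z \<in> J3" "f Z = X" for X Z
    using bij_betw_inv_into_left[OF f(1) that(1)] that(2) by simp
  show ?thesis
    unfolding det_preserver_def
  proof (intro conjI ballI allI)
    show "?g (X + Y) = ?g X + ?g Y" if "X \<in> J3" "Y \<in> J3" for X Y
      by (rule eqI) (simp_all add: that f gJ fg J3_add)
    show "?g (cscale c X) = cscale c (?g X)" if "X \<in> J3" for c X
      by (rule eqI) (simp_all add: that f gJ fg J3_cscale)
    show "det (?g X) = det X" if "X \<in> J3" for X
      using f(5)[OF gJ[OF that]] fg[OF that] by simp
  qed (rule g)
qed

lemma congruence_cscale: "P ** cscale c X ** Q = cscale c (P ** X ** Q)"
  by (simp add: mat3_simps algebra_simps)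

lemma congruence_add: "P ** (X + Y) ** Q = P ** X ** Q + P ** Y ** (Q :: cmat3)"
  by (simp add: matrix_matrix_mult_def vec_eq_iff sum_distrib_left sum_distrib_right
      sum.distrib algebra_simps)

lemma det_preserver_congruence:
  assumes "det P ^ 2 = 1"
  shows "det_preserver (\<lambda>X. P ** X ** transpose P)"
proof -
  obtain Q where Q: "Q ** P = mat 1" "P ** Q = mat 1"
    using det_eq_1_imp_invertible[OF assms] by blast
  have cancel: "A ** (B ** X ** transpose B) ** transpose A = X"
    if "A ** B = mat 1" for A B X :: cmat3
  proof -
    have "A ** (B ** X ** transpose B) ** transpose A = (A ** B) ** X ** transpose (A ** B)"
      by (simp add: matrix_transpose_mul matrix_mul_assoc)
    then show ?thesis using that by simp
  qed
  have "bij_betw (\<lambda>X. P ** X ** transpose P) J3 J3"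
    by (rule bij_betw_byWitness[where f' = "\<lambda>X. Q ** X ** transpose Q"])
      (auto simp: cancel Q J3_congruence)
  moreover have "det (P ** X ** transpose P) = det X" for X
  proof -
    have "det (P ** X ** transpose P) = det P ^ 2 * det X"
      by (simp add: det_mul power2_eq_square)
    then show ?thesis using assms by simp
  qed
  ultimately show ?thesis
    by (auto simp: det_preserver_def congruence_cscale congruence_add)
qed

section \<open>The basis of \<open>J3\<close> and its elements of rank at most one\<close>

text \<open>For \<open>i = j\<close> this is the idempotent E_i, otherwise F_ij. The disjunction
  makes the diagonal entry 1, where a sum of two matrix units would give 2.\<close>

definition sym_unit :: "3 \<Rightarrow> 3 \<Rightarrow> cmat3" where
  "sym_unit i j = (\<chi> a b. if a = i \<and> b = j \<or> a = j \<and> b = i then 1 else 0)"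

lemma sym_unit_nth:
  "sym_unit i j $ a $ b = (if a = i \<and> b = j \<or> a = j \<and> b = i then 1 else 0)"
  by (simp add: sym_unit_def)

lemma ex_3: "(\<exists>i::3. P i) \<longleftrightarrow> P 1 \<or> P 2 \<or> P 3"
  by (metis exhaust_3)

lemma sym_unit_J3 [simp]: "sym_unit i j \<in> J3"
  by (auto simp: J3_iff sym_unit_nth)

lemma J3_decomp:
  assumes "X \<in> J3"
  shows "X = cscale (X$1$1) (sym_unit 1 1) + (cscale (X$2$2) (sym_unit 2 2) +
     (cscale (X$3$3) (sym_unit 3 3) + (cscale (X$1$2) (sym_unit 1 2) +
     (cscale (X$1$3) (sym_unit 1 3) + cscale (X$2$3) (sym_unit 2 3)))))"
  using J3_sym[OF assms] by (simp add: vec_eq_iff forall_3 sym_unit_nth)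

lemma det_preserver_decomp:
  assumes "det_preserver f" "X \<in> J3"
  shows "f X = cscale (X$1$1) (f (sym_unit 1 1)) + (cscale (X$2$2) (f (sym_unit 2 2)) +
     (cscale (X$3$3) (f (sym_unit 3 3)) + (cscale (X$1$2) (f (sym_unit 1 2)) +
     (cscale (X$1$3) (f (sym_unit 1 3)) + cscale (X$2$3) (f (sym_unit 2 3))))))"
  by (subst J3_decomp[OF assms(2)])
    (simp add: det_preserverD[OF assms(1)] J3_add J3_cscale)

text \<open>The quadratic term of \<open>t \<mapsto> det (Y + t X)\<close> is the trace of the product of \<open>Y\<close> with the
  adjugate of \<open>X\<close>, so a symmetric matrix has rank at most one iff it satisfies this
  condition, which every determinant preserver respects.\<close>

definition quadratic_free :: "cmat3 \<Rightarrow> bool" where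
  "quadratic_free X \<longleftrightarrow> (\<forall>Y\<in>J3. det (Y + X) + det (Y + cscale (-1) X) = 2 * det Y)"

text \<open>The test matrix \<open>Y\<close> runs over all of \<open>J3\<close>. Since
  \<open>f\<close> is onto, \<open>Y = f Z\<close>, and by linearity the condition for
  \<open>f X\<close> at \<open>Y\<close> is the condition for \<open>X\<close> at
  \<open>Z\<close>.\<close>

lemma quadratic_free_det_preserver:
  assumes "det_preserver f" "X \<in> J3" "quadratic_free X"
  shows "quadratic_free (f X)"
  unfolding quadratic_free_def
proof
  fix Y assume "Y \<in> J3"
  then obtain Z where Z: "Z \<in> J3" "Y = f Z"
    using det_preserverD(1)[OF assms(1)] by (auto simp: bij_betw_def)
  have "Y + f X = f (Z + X)" "Y + cscale (-1) (f X) = f (Z + cscale (-1) X)"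
    using Z assms(2) by (simp_all add: det_preserverD[OF assms(1)] J3_cscale)
  then show "det (Y + f X) + det (Y + cscale (-1) (f X)) = 2 * det Y"
    using det_preserverD(5)[OF assms(1)] Z assms(2,3)
    by (simp only: J3_add J3_cscale quadratic_free_def)
qed

text \<open>For \<open>X\<close> = w w^T the determinant of Y + t X is affine in t, so its values at
  t = 1 and t = -1 average to \<open>det Y\<close>.\<close>

lemma quadratic_free_rank1:
  assumes "\<And>i j. X $ i $ j = w $ i * w $ j"
  shows "quadratic_free X"
  unfolding quadratic_free_def det_3 by (simp add: assms algebra_simps)

text \<open>The condition says that the trace of Y adj(X) vanishes for all symmetric
  \<open>Y\<close>. Taking \<open>Y\<close> through the six basis matrices kills every entry of the
  symmetric matrix adj(X), that is, every 2x2 minor of \<open>X\<close>.\<close>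

lemma quadratic_free_minor:
  assumes "X \<in> J3" "quadratic_free X"
  shows "X $ i $ j * X $ k $ l = X $ i $ l * X $ k $ j"
proof -
  have q: "det (sym_unit a b + X) + det (sym_unit a b + cscale (-1) X) = 2 * det (sym_unit a b)"
    for a b using assms(2) by (simp add: quadratic_free_def)
  have s: "X$2$1 = X$1$2" "X$3$1 = X$1$3" "X$3$2 = X$2$3"
    using J3_sym[OF assms(1)] by auto
  note simps = det_3 sym_unit_nth s
  have "X$2$2 * X$3$3 = X$2$3 * X$2$3"
    using q[of 1 1] by (simp add: simps algebra_simps)
  moreover have "X$1$1 * X$3$3 = X$1$3 * X$1$3"
    using q[of 2 2] by (simp add: simps algebra_simps)
  moreover have "X$1$1 * X$2$2 = X$1$2 * X$1$2"
    using q[of 3 3] by (simp add: simps algebra_simps)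
  moreover have "X$1$2 * X$3$3 = X$1$3 * X$2$3"
    using q[of 1 2] by (simp add: simps algebra_simps)
  moreover have "X$1$3 * X$2$2 = X$1$2 * X$2$3"
    using q[of 1 3] by (simp add: simps algebra_simps)
  moreover have "X$2$3 * X$1$1 = X$1$2 * X$1$3"
    using q[of 2 3] by (simp add: simps algebra_simps)
  ultimately have "\<forall>i j k l. X $ i $ j * X $ k $ l = X $ i $ l * X $ k $ j"
    by (simp add: forall_3 s mult.commute)
  then show ?thesis by blast
qed

text \<open>If some \<open>X $ k $ k\<close> is nonzero, column \<open>k\<close> divided by a
  complex square root of that entry serves as \<open>w\<close>. If the diagonal vanishes, the
  principal minors make every entry square to zero, so \<open>X\<close> is zero.\<close>

lemma quadratic_free_imp_rank1:
  assumes "X \<in> J3" "quadratic_free X"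
  obtains w :: "complex^3" where "\<And>i j. X $ i $ j = w $ i * w $ j"
proof (cases "\<exists>k. X $ k $ k \<noteq> 0")
  case True
  then obtain k where k: "X $ k $ k \<noteq> 0" by blast
  define r where "r = csqrt (X $ k $ k)"
  have r: "r * r = X $ k $ k"
    by (metis r_def power2_csqrt power2_eq_square)
  have "X $ i $ j = (\<chi> i. X $ i $ k / r) $ i * (\<chi> i. X $ i $ k / r) $ j" for i j
    using quadratic_free_minor[OF assms, of i j k k] k J3_sym[OF assms(1), of k j]
    by (simp add: r field_simps)
  then show ?thesis by (rule that)
next
  case False
  have "X $ i $ j = 0" for i j
    using quadratic_free_minor[OF assms, of i i j j] False J3_sym[OF assms(1), of j i] by auto
  then show ?thesis by (intro that[of 0]) simp
qed

section \<open>Determinant preservers are congruences\<close>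

text \<open>The coefficients of t, t^3 and t^2 in the identity give \<open>a = 0\<close>,
  \<open>b = 0\<close> and c^2 = 1 + a b. The values at 1, -1 and 2 suffice: the first two yield
  \<open>b = - a\<close>, the third then \<open>a = 0\<close>.\<close>

lemma quadratic_identity_coeffs:
  fixes a b c :: complex
  assumes "\<And>t. (t * t + t * a) * (1 + t * b) = (t * c) * (t * c)"
  shows "a = 0" "b = 0" "c * c = 1"
proof -
  have t: "(1 + a) * (1 + b) = c * c" "(1 - a) * (1 - b) = c * c" "(4 + 2 * a) * (1 + 2 * b) = 4 * (c * c)"
    using assms[of 1] assms[of "-1"] assms[of 2] by simp_all
  have "2 * (a + b) = (1 + a) * (1 + b) - (1 - a) * (1 - b)" by (simp add: algebra_simps)
  then have "2 * (a + b) = 0" by (simp only: t) simp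
  then have b: "b = - a" by (simp add: add_eq_0_iff)
  have "6 * a = 4 * ((1 + a) * (1 + b)) - (4 + 2 * a) * (1 + 2 * b)"
    by (simp add: b algebra_simps)
  then have "6 * a = 0" by (simp only: t) simp
  then show "a = 0" "b = 0" "c * c = 1" using b t(1) by auto
qed

lemma det_preserver_off_diagonal:
  assumes f: "det_preserver f" and diag: "\<And>i. f (sym_unit i i) = sym_unit i i" and "i \<noteq> j"
  obtains e where "e * e = 1" "f (sym_unit i j) = cscale e (sym_unit i j)"
proof -
  define M where "M = f (sym_unit i j)"
  have "\<exists>k. k \<noteq> i \<and> k \<noteq> j \<and> (\<forall>a. a = i \<or> a = j \<or> a = k)"
    using \<open>i \<noteq> j\<close> exhaust_3[of i] exhaust_3[of j]
    by (elim disjE) (auto simp: ex_3 forall_3)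
  then obtain k where k: "k \<noteq> i" "k \<noteq> j" and ex: "\<And>a. a = i \<or> a = j \<or> a = k"
    by blast
  have MJ: "M \<in> J3" by (simp add: M_def det_preserverD[OF f])
  \<comment> \<open>\<open>R t\<close> is v v^T for the vector v with entry \<open>t\<close> at
    \<open>i\<close>, 1 at \<open>j\<close> and 0 at \<open>k\<close>. Its image \<open>N t\<close>
    differs only in having \<open>M\<close> for F_ij, and all 2x2 minors of \<open>N t\<close> must
    vanish.\<close>
  define R where "R t = cscale (t * t) (sym_unit i i) + (sym_unit j j + cscale t (sym_unit i j))" for t
  define N where "N t = cscale (t * t) (sym_unit i i) + (sym_unit j j + cscale t M)" for t
  have RJ: "R t \<in> J3" for t by (simp add: R_def J3_add J3_cscale)
  have fR: "f (R t) = N t" for t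
    by (simp add: R_def N_def M_def det_preserverD[OF f] J3_add J3_cscale diag)
  have "R t $ a $ b = (\<chi> a. if a = i then t else if a = j then 1 else 0) $ a *
      (\<chi> a. if a = i then t else if a = j then 1 else 0) $ b" for t a b
    using \<open>i \<noteq> j\<close> by (auto simp: R_def sym_unit_nth)
  then have "quadratic_free (R t)" for t by (rule quadratic_free_rank1)
  then have "quadratic_free (N t)" for t
    using quadratic_free_det_preserver[OF f RJ] fR by metis
  moreover have "N t \<in> J3" for t using fR RJ det_preserverD(2)[OF f] by metis
  ultimately have minor: "N t $ a $ b * N t $ c $ d = N t $ a $ d * N t $ c $ b" for t a b c d
    using quadratic_free_minor by blast
  have sM: "M $ j $ i = M $ i $ j" "M $ k $ i = M $ i $ k" "M $ k $ j = M $ j $ k"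
    using J3_sym[OF MJ] by auto
  have N_nth: "N t $ i $ i = t * t + t * M$i$i" "N t $ j $ j = 1 + t * M$j$j"
    "N t $ k $ k = t * M$k$k" "N t $ i $ j = t * M$i$j" "N t $ j $ i = t * M$i$j"
    "N t $ i $ k = t * M$i$k" "N t $ k $ i = t * M$i$k"
    "N t $ j $ k = t * M$j$k" "N t $ k $ j = t * M$j$k" for t
    using \<open>i \<noteq> j\<close> k by (simp_all add: N_def sym_unit_nth sM)
  have ij: "(t * t + t * M$i$i) * (1 + t * M$j$j) = (t * M$i$j) * (t * M$i$j)" for t
    using minor[of t i i j j] by (simp only: N_nth)
  have ik: "(t * t + t * M$i$i) * (t * M$k$k) = (t * M$i$k) * (t * M$i$k)" for t
    using minor[of t i i k k] by (simp only: N_nth)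
  have jk: "(1 + t * M$j$j) * (t * M$k$k) = (t * M$j$k) * (t * M$j$k)" for t
    using minor[of t j j k k] by (simp only: N_nth)
  have ii: "M$i$i = 0" and jj: "M$j$j = 0" and e: "M$i$j * M$i$j = 1"
    using quadratic_identity_coeffs[OF ij] by auto
  \<comment> \<open>With \<open>M$i$i = 0\<close> the minor reads t^3 \<open>M$k$k\<close> = t^2
    (\<open>M$i$k\<close>)^2. The signs of t = 1 and t = -1 force both sides to vanish.\<close>
  have kk: "M$k$k = 0" and mik: "M$i$k = 0"
    using ik[of 1] ik[of "-1"] by (auto simp: ii)
  have mjk: "M$j$k = 0"
    using jk[of 1] by (simp add: jj kk)
  have entries: "M $ a $ b = cscale (M$i$j) (sym_unit i j) $ a $ b" for a b
    using ex[of a] ex[of b] k \<open>i \<noteq> j\<close> ii jj kk mik mjk sM by (auto simp: sym_unit_nth)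
  have "M = cscale (M$i$j) (sym_unit i j)"
    unfolding vec_eq_iff using entries by blast
  then show ?thesis using that e M_def by metis
qed

definition diag3 :: "complex \<Rightarrow> complex \<Rightarrow> complex \<Rightarrow> cmat3" where
  "diag3 a b c = vector [vector [a, 0, 0], vector [0, b, 0], vector [0, 0, c]]"

lemma det_preserver_fixing_diagonal:
  assumes f: "det_preserver f" and diag: "\<And>i. f (sym_unit i i) = sym_unit i i"
  obtains D where "det D ^ 2 = 1" "\<And>X. X \<in> J3 \<Longrightarrow> f X = D ** X ** transpose D"
proof -
  note off = det_preserver_off_diagonal[OF f diag]
  obtain a where a: "a * a = 1" "f (sym_unit 1 2) = cscale a (sym_unit 1 2)"
    using off[of 1 2] by auto
  obtain b where b: "b * b = 1" "f (sym_unit 1 3) = cscale b (sym_unit 1 3)"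
    using off[of 1 3] by auto
  obtain c where c: "c * c = 1" "f (sym_unit 2 3) = cscale c (sym_unit 2 3)"
    using off[of 2 3] by auto
  have fX: "f X = cscale (X$1$1) (sym_unit 1 1) + (cscale (X$2$2) (sym_unit 2 2) +
     (cscale (X$3$3) (sym_unit 3 3) + (cscale (X$1$2) (cscale a (sym_unit 1 2)) +
     (cscale (X$1$3) (cscale b (sym_unit 1 3)) + cscale (X$2$3) (cscale c (sym_unit 2 3))))))"
    if "X \<in> J3" for X
    using det_preserver_decomp[OF f that] by (simp add: diag a b c)
  \<comment> \<open>The determinant of \<open>U\<close> is 2 and that of its image is 2
    \<open>a\<close> \<open>b\<close> \<open>c\<close>; this is the only relation among the three
    signs.\<close>
  define U where "U = sym_unit 1 2 + (sym_unit 1 3 + sym_unit 2 3)"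
  have "U \<in> J3" by (simp add: U_def J3_add)
  from det_preserverD(5)[OF f this] have "a * b * c = 1"
    by (simp add: fX[OF \<open>U \<in> J3\<close>] det_3) (simp add: U_def sym_unit_nth algebra_simps)
  then have "(a * a) * (b * b) * c = a * b" by (simp add: algebra_simps)
  then have cab: "c = a * b" using a b by simp
  show ?thesis
  \<comment> \<open>Congruence by diag(1, a, b) fixes each E_i because \<open>a\<close> and
    \<open>b\<close> square to 1, and multiplies F_12, F_13, F_23 by a, b and a b = c.\<close>
  proof (rule that[of "diag3 1 a b"])
    show "det (diag3 1 a b) ^ 2 = 1"
      using a(1) b(1) by (simp add: det_3 diag3_def power2_eq_square algebra_simps)
    fix X assume X: "X \<in> J3"
    show "f X = diag3 1 a b ** X ** transpose (diag3 1 a b)"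
      using J3_sym[OF X] a(1) b(1)
      by (simp add: fX[OF X] mat3_simps diag3_def sym_unit_nth cab)
  qed
qed

text \<open>Only \<open>det P ^ 2\<close> can be prescribed for a given \<open>f\<close>:
  \<open>P\<close> and its negative induce the same congruence but have opposite
  determinants.\<close>

lemma det_preserver_eq_congruence:
  assumes f: "det_preserver f"
  obtains P where "det P ^ 2 = 1" "\<And>X. X \<in> J3 \<Longrightarrow> f X = P ** X ** transpose P"
proof -
  have "\<exists>w::complex^3. \<forall>a b. f (sym_unit i i) $ a $ b = w $ a * w $ b" for i
  proof -
    have "sym_unit i i $ a $ b = axis i 1 $ a * axis i 1 $ b" for a b
      by (simp add: sym_unit_nth axis_def)
    then have "quadratic_free (f (sym_unit i i))"
      using quadratic_free_det_preserver[OF f] quadratic_free_rank1 sym_unit_J3 by blast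
    then show ?thesis
      using quadratic_free_imp_rank1 det_preserverD(2)[OF f] sym_unit_J3 by metis
  qed
  then obtain w :: "3 \<Rightarrow> complex^3"
    where w: "\<And>i a b. f (sym_unit i i) $ a $ b = w i $ a * w i $ b"
    by metis
  \<comment> \<open>The columns of \<open>W\<close> are the vectors \<open>w i\<close>, so
    congruence by \<open>W\<close> sends E_i to w_i w_i^T, which is its image under
    \<open>f\<close>.\<close>
  define W :: cmat3 where "W = (\<chi> a i. w i $ a)"
  have W: "f (sym_unit i i) = W ** sym_unit i i ** transpose W" for i
    using exhaust_3[of i] by (auto simp: mat3_simps w W_def sym_unit_nth)
  have I: "mat 1 = sym_unit 1 1 + (sym_unit 2 2 + sym_unit 3 3)"
    by (simp add: mat3_simps mat_def sym_unit_nth)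
  \<comment> \<open>As the identity is the sum of the E_i, its image is W W^T, and preservation of
    its determinant shows that \<open>W\<close> is invertible.\<close>
  have "f (mat 1) = W ** mat 1 ** transpose W"
    unfolding I
    by (simp add: det_preserverD[OF f] J3_add W congruence_add)
  moreover have "det (f (mat 1)) = 1"
    by (subst det_preserverD(5)[OF f]) (simp_all add: J3_def)
  ultimately have dW: "det W ^ 2 = 1"
    by (simp add: det_mul power2_eq_square)
  then obtain V where V: "V ** W = mat 1" "W ** V = mat 1" "det V ^ 2 = 1"
    by (rule det_eq_1_imp_invertible)
  define g where "g X = V ** f X ** transpose V" for X
  have g: "det_preserver g"
    unfolding g_def
    by (rule det_preserver_comp[OF det_preserver_congruence[OF V(3)] f])
  have "g (sym_unit i i) = (V ** W) ** sym_unit i i ** transpose (V ** W)" for i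
    by (simp add: g_def W matrix_transpose_mul matrix_mul_assoc)
  then have "g (sym_unit i i) = sym_unit i i" for i by (simp add: V)
  then obtain D where D: "det D ^ 2 = 1" "\<And>X. X \<in> J3 \<Longrightarrow> g X = D ** X ** transpose D"
    using det_preserver_fixing_diagonal[OF g] by blast
  show ?thesis
  proof (rule that[of "W ** D"])
    show "det (W ** D) ^ 2 = 1" using dW D(1) by (simp add: det_mul power_mult_distrib)
    fix X assume X: "X \<in> J3"
    have "f X = (W ** V) ** f X ** transpose (W ** V)" by (simp add: V)
    also have "\<dots> = W ** g X ** transpose W"
      by (simp add: g_def matrix_transpose_mul matrix_mul_assoc)
    also have "\<dots> = (W ** D) ** X ** transpose (W ** D)"
      by (simp add: D(2)[OF X] matrix_transpose_mul matrix_mul_assoc)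
    finally show "f X = (W ** D) ** X ** transpose (W ** D)" .
  qed
qed

section \<open>The hermitian form under congruence\<close>

lemma tau_mult: "tau (A ** B) = tau A ** tau B"
  by (simp add: tau_def mat3_simps)

lemma tau_tau [simp]: "tau (tau A) = A"
  by (simp add: tau_def vec_eq_iff)

lemma tau_transpose: "tau (transpose A) = transpose (tau A)"
  by (simp add: tau_def mat3_simps)

lemma tau_mat1 [simp]: "tau (mat 1) = mat 1"
  by (simp add: tau_def mat_def vec_eq_iff)

lemma det_tau: "det (tau A) = cnj (det A)"
  by (simp add: tau_def det_3)

lemma I1_nth [simp]:
  "I1$1$1 = -1" "I1$1$2 = 0" "I1$1$3 = 0" "I1$2$1 = 0" "I1$2$2 = 1" "I1$2$3 = 0"
  "I1$3$1 = 0" "I1$3$2 = 0" "I1$3$3 = 1"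
  by (simp_all add: I1_def)

lemma tau_I1 [simp]: "tau I1 = I1"
  by (simp add: tau_def vec_eq_iff forall_3)

lemma transpose_I1 [simp]: "transpose I1 = I1"
  by (simp add: mat3_simps)

lemma I1_I1 [simp]: "I1 ** I1 = mat 1"
  by (simp add: mat3_simps mat_def)

lemma det_I1 [simp]: "det I1 = -1"
  by (simp add: det_3)

lemma trace_mult_comm: "trace (A ** B) = trace (B ** (A :: cmat3))"
  by (simp add: trace_def mat3_simps algebra_simps)

text \<open>Cycling \<open>transpose P\<close> to the front of the trace collects \<open>P\<close>
  into \<open>H\<close> and its conjugate. The pulled back form is the original one, as written in
  \<open>herm_sigma_eq\<close>, with \<open>tau H\<close> and \<open>H\<close> in place of the two
  factors \<open>I1\<close>.\<close>

lemma herm_sigma_congruence: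
  fixes P X Y :: cmat3
  defines "H \<equiv> tau (transpose P) ** I1 ** P"
  assumes "X \<in> J3"
  shows "herm_sigma (P ** X ** transpose P) (P ** Y ** transpose P) =
    trace (tau H ** tau X ** H ** Y)"
proof -
  have "herm_sigma (P ** X ** transpose P) (P ** Y ** transpose P) =
      trace ((I1 ** tau P ** tau X ** H ** Y) ** transpose P)"
    by (simp add: herm_sigma_def bil_def sigma_def H_def tau_mult matrix_mul_assoc)
  also have "\<dots> = trace (tau H ** tau X ** H ** Y)"
    by (subst trace_mult_comm) (simp add: H_def tau_mult matrix_mul_assoc)
  finally show ?thesis .
qed

lemma herm_sigma_eq: "herm_sigma X Y = trace (I1 ** tau X ** I1 ** Y)"
  by (simp add: herm_sigma_def bil_def sigma_def tau_mult)

text \<open>Since \<open>I1\<close> squares to the identity, the hypothesis makes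
  \<open>I1 ** tau (transpose A) ** I1\<close> a right inverse of \<open>A\<close>, hence also a
  left inverse. This order of the factors is the one that occurs in the form.\<close>

lemma SU_sym:
  assumes "A ** I1 ** tau (transpose A) = I1"
  shows "tau (transpose A) ** I1 ** A = I1"
proof -
  have "A ** (I1 ** tau (transpose A) ** I1) = mat 1"
    using assms by (simp add: matrix_mul_assoc)
  then have "(I1 ** tau (transpose A) ** I1) ** A = mat 1"
    by (simp add: matrix_left_right_inverse)
  then have "I1 ** ((I1 ** tau (transpose A) ** I1) ** A) = I1" by simp
  then show ?thesis by (simp add: matrix_mul_assoc)
qed

lemma SU_sym_converse:
  assumes "tau (transpose A) ** I1 ** A = I1"
  shows "A ** I1 ** tau (transpose A) = I1"
  using SU_sym[of "tau (transpose A)"] assms by (simp add: tau_transpose)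

lemma herm_sigma_congruence_SU:
  assumes "A ** I1 ** tau (transpose A) = I1" "X \<in> J3"
  shows "herm_sigma (A ** X ** transpose A) (A ** Y ** transpose A) = herm_sigma X Y"
  using herm_sigma_congruence[OF assms(2)] SU_sym[OF assms(1)] by (simp add: herm_sigma_eq)

text \<open>The pairs E_i, E_j show that \<open>H\<close> is diagonal with entries 1 or -1. The
  pairs F_12, F_12 and F_23, F_23 fix the products of neighbouring entries, which leaves
  \<open>I1\<close> and its negative; \<open>det H = -1\<close> excludes the latter.\<close>

lemma congruence_herm_sigma_imp_SU:
  assumes det: "det P = 1"
    and herm: "\<And>X Y. X \<in> J3 \<Longrightarrow> Y \<in> J3 \<Longrightarrow>
      herm_sigma (P ** X ** transpose P) (P ** Y ** transpose P) = herm_sigma X Y"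
  shows "P ** I1 ** tau (transpose P) = I1"
proof -
  define H where "H = tau (transpose P) ** I1 ** P"
  have tr: "trace (tau H ** tau X ** H ** Y) = trace (I1 ** tau X ** I1 ** Y)"
    if "X \<in> J3" "Y \<in> J3" for X Y
    using herm[OF that] herm_sigma_congruence[OF that(1)] by (simp add: H_def herm_sigma_eq)
  have "transpose (tau H) = H"
    by (simp add: H_def tau_mult matrix_transpose_mul tau_transpose matrix_mul_assoc)
  then have "transpose (tau H) $ i $ j = H $ i $ j" for i j by simp
  then have cnjH: "cnj (H $ j $ i) = H $ i $ j" for i j
    by (simp add: transpose_def tau_def)
  \<comment> \<open>The trace is the product of the conjugate of \<open>H$j$i\<close> with
    \<open>H$i$j\<close>. It is a square, rather than a squared modulus, because \<open>H\<close> is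
    hermitian.\<close>
  have sq: "trace (tau H ** tau (sym_unit i i) ** H ** sym_unit j j) = H$i$j * H$i$j" for i j
    using exhaust_3[of i] exhaust_3[of j]
    by (auto simp: trace_def mat3_simps tau_def sym_unit_nth cnjH)
  have sq': "trace (I1 ** tau (sym_unit i i) ** I1 ** sym_unit j j) = (if i = j then 1 else 0)" for i j
    using exhaust_3[of i] exhaust_3[of j]
    by (auto simp: trace_def mat3_simps tau_def sym_unit_nth)
  have H2: "H$i$j * H$i$j = (if i = j then 1 else 0)" for i j
    using tr[of "sym_unit i i" "sym_unit j j"] sq sq' by simp
  have off: "H$i$j = 0" if "i \<noteq> j" for i j
    using H2[of i j] that by simp
  have "H$1$1 * H$2$2 = -1"
    using tr[of "sym_unit 1 2" "sym_unit 1 2"]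
    by (simp add: trace_def mat3_simps tau_def sym_unit_nth cnjH off)
  moreover have "H$2$2 * H$3$3 = 1"
    using tr[of "sym_unit 2 3" "sym_unit 2 3"]
    by (simp add: trace_def mat3_simps tau_def sym_unit_nth cnjH off)
  moreover have "det H = -1"
    by (simp add: H_def det_mul det_tau det)
  then have "H$1$1 * H$2$2 * H$3$3 = -1"
    by (simp add: det_3 off)
  ultimately have "H$1$1 = -1" "H$2$2 = 1" "H$3$3 = 1"
    using H2[of 2 2] by algebra+
  then have "H = I1" by (simp add: vec_eq_iff forall_3 off)
  then show ?thesis using SU_sym_converse H_def by simp
qed

section \<open>Both structures are groups\<close>

lemma carrier_E6:
  "carrier E6_m14_R = {\<alpha> \<in> extensional J3. det_preserver \<alpha> \<and>
     (\<forall>X\<in>J3. \<forall>Y\<in>J3. herm_sigma (\<alpha> X) (\<alpha> Y) = herm_sigma X Y)}"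
  by (auto simp: E6_m14_R_def Iso_C_def BijGroup_def Bij_def det_preserver_def)

lemma E6_eq: "E6_m14_R = (BijGroup J3)\<lparr>carrier := carrier E6_m14_R\<rparr>"
  by (simp add: E6_m14_R_def Iso_C_def)

lemma carrier_E6_Bij: "\<alpha> \<in> carrier E6_m14_R \<Longrightarrow> \<alpha> \<in> Bij J3"
  by (auto simp: carrier_E6 Bij_def det_preserver_def)

lemma mult_E6:
  assumes "\<alpha> \<in> carrier E6_m14_R" "\<beta> \<in> carrier E6_m14_R"
  shows "\<alpha> \<otimes>\<^bsub>E6_m14_R\<^esub> \<beta> = (\<lambda>X\<in>J3. \<alpha> (\<beta> X))"
  using assms[THEN carrier_E6_Bij]
  by (simp add: E6_m14_R_def Iso_C_def BijGroup_def compose_def)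

text \<open>It is a subgroup of the group of all bijections of \<open>J3\<close>, where the inverse
  is \<open>inv_into\<close> restricted to \<open>J3\<close>.\<close>

lemma group_E6: "group E6_m14_R"
proof -
  interpret B: group "BijGroup J3" by (rule group_BijGroup)
  have "subgroup (carrier E6_m14_R) (BijGroup J3)"
  proof (rule B.subgroupI)
    show "carrier E6_m14_R \<subseteq> carrier (BijGroup J3)"
      using carrier_E6_Bij by (auto simp: BijGroup_def)
    have "det_preserver (\<lambda>X\<in>J3. X)"
      by (simp add: det_preserver_def J3_add J3_cscale bij_betw_def inj_on_def)
    then have "(\<lambda>X\<in>J3. X) \<in> carrier E6_m14_R" by (simp add: carrier_E6)
    then show "carrier E6_m14_R \<noteq> {}" by blast
  next
    fix \<alpha> assume \<alpha>: "\<alpha> \<in> carrier E6_m14_R"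
    then have dp: "det_preserver \<alpha>"
      and herm: "\<And>X Y. X \<in> J3 \<Longrightarrow> Y \<in> J3 \<Longrightarrow> herm_sigma (\<alpha> X) (\<alpha> Y) = herm_sigma X Y"
      by (auto simp: carrier_E6)
    note dpi = det_preserver_inv_into[OF dp]
    have right: "\<alpha> (inv_into J3 \<alpha> X) = X" if "X \<in> J3" for X
      using that det_preserverD(1)[OF dp] by (simp add: bij_betw_inv_into_right)
    have "herm_sigma (inv_into J3 \<alpha> X) (inv_into J3 \<alpha> Y) = herm_sigma X Y"
      if "X \<in> J3" "Y \<in> J3" for X Y
      using herm[of "inv_into J3 \<alpha> X" "inv_into J3 \<alpha> Y"] that
      by (simp add: right det_preserverD(2)[OF dpi])
    moreover have "det_preserver (\<lambda>X\<in>J3. inv_into J3 \<alpha> X)"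
      using dpi det_preserver_cong[of "\<lambda>X\<in>J3. inv_into J3 \<alpha> X" "inv_into J3 \<alpha>"] by simp
    ultimately show "inv\<^bsub>BijGroup J3\<^esub> \<alpha> \<in> carrier E6_m14_R"
      by (simp add: inv_BijGroup carrier_E6_Bij[OF \<alpha>] carrier_E6)
  next
    fix \<alpha> \<beta> assume \<alpha>: "\<alpha> \<in> carrier E6_m14_R" and \<beta>: "\<beta> \<in> carrier E6_m14_R"
    have "det_preserver (\<lambda>X\<in>J3. \<alpha> (\<beta> X))"
      using det_preserver_comp[of \<alpha> \<beta>] \<alpha> \<beta>
        det_preserver_cong[of "\<lambda>X\<in>J3. \<alpha> (\<beta> X)" "\<lambda>X. \<alpha> (\<beta> X)"]
      by (simp add: carrier_E6)
    then have "(\<lambda>X\<in>J3. \<alpha> (\<beta> X)) \<in> carrier E6_m14_R"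
      using \<alpha> \<beta> det_preserverD(2)[of \<beta>] by (simp add: carrier_E6)
    then show "\<alpha> \<otimes>\<^bsub>BijGroup J3\<^esub> \<beta> \<in> carrier E6_m14_R"
      using carrier_E6_Bij[OF \<alpha>] carrier_E6_Bij[OF \<beta>]
      by (simp add: BijGroup_def compose_def)
  qed
  from B.subgroup_imp_group[OF this] show ?thesis using E6_eq by simp
qed

lemma SU_mult:
  assumes "A ** I1 ** tau (transpose A) = I1" "B ** I1 ** tau (transpose B) = I1"
  shows "(A ** B) ** I1 ** tau (transpose (A ** B)) = I1"
proof -
  have "(A ** B) ** I1 ** tau (transpose (A ** B)) =
      A ** (B ** I1 ** tau (transpose B)) ** tau (transpose A)"
    by (simp add: matrix_transpose_mul tau_mult matrix_mul_assoc)
  then show ?thesis using assms by simp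
qed

lemma group_SU: "group SU_1_2"
proof (rule groupI)
  fix A assume "A \<in> carrier SU_1_2"
  then have A: "A ** I1 ** tau (transpose A) = I1" "det A = 1" by (auto simp: SU_1_2_def)
  \<comment> \<open>The inverse read off from A^* I1 A = I1, where A^* is the conjugate
    transpose.\<close>
  let ?B = "I1 ** tau (transpose A) ** I1"
  have "?B ** A = I1 ** (tau (transpose A) ** I1 ** A)" by (simp add: matrix_mul_assoc)
  then have inv: "?B ** A = mat 1" using SU_sym[OF A(1)] by simp
  \<comment> \<open>The right side is bracketed so that cancelling \<open>I1 ** I1\<close> leaves
    A^* I1 A inside. \<open>I1_I1\<close> is withheld here so that both sides reassociate to the
    same product before anything cancels.\<close>
  have "?B ** I1 ** tau (transpose ?B) =
      I1 ** (tau (transpose A) ** (I1 ** I1) ** I1 ** A) ** I1"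
    by (simp add: matrix_transpose_mul tau_mult tau_transpose matrix_mul_assoc
        del: I1_I1)
  then have "?B ** I1 ** tau (transpose ?B) = I1" using SU_sym[OF A(1)] by simp
  moreover have "det ?B = 1" using A(2) by (simp add: det_mul det_tau tau_transpose)
  ultimately show "\<exists>B\<in>carrier SU_1_2. B \<otimes>\<^bsub>SU_1_2\<^esub> A = \<one>\<^bsub>SU_1_2\<^esub>"
    using inv by (auto simp: SU_1_2_def)
qed (auto simp: SU_1_2_def SU_mult det_mul matrix_mul_assoc)

section \<open>The isomorphism given by congruence\<close>

definition congruence_map :: "cmat3 \<Rightarrow> cmat3 \<Rightarrow> cmat3" where
  "congruence_map A = (\<lambda>X\<in>J3. A ** X ** transpose A)"

lemma congruence_map_E6:
  assumes "A \<in> carrier SU_1_2"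
  shows "congruence_map A \<in> carrier E6_m14_R"
proof -
  have A: "A ** I1 ** tau (transpose A) = I1" "det A = 1" using assms by (auto simp: SU_1_2_def)
  have "det_preserver (congruence_map A)"
    using det_preserver_congruence[of A] A(2)
      det_preserver_cong[of "congruence_map A" "\<lambda>X. A ** X ** transpose A"]
    by (simp add: congruence_map_def)
  then show ?thesis
    using herm_sigma_congruence_SU[OF A(1)] by (simp add: carrier_E6 congruence_map_def)
qed

lemma congruence_map_mult:
  "congruence_map (A ** B) = (\<lambda>X\<in>J3. congruence_map A (congruence_map B X))"
  by (simp add: congruence_map_def J3_congruence matrix_transpose_mul matrix_mul_assoc
      cong: restrict_cong)

lemma congruence_map_hom: "congruence_map \<in> hom SU_1_2 E6_m14_R"
proof (rule homI)
  fix A B assume "A \<in> carrier SU_1_2" "B \<in> carrier SU_1_2"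
  then show "congruence_map (A \<otimes>\<^bsub>SU_1_2\<^esub> B) = congruence_map A \<otimes>\<^bsub>E6_m14_R\<^esub> congruence_map B"
    by (simp add: mult_E6 congruence_map_E6 congruence_map_mult) (simp add: SU_1_2_def congruence_map_mult)
qed (rule congruence_map_E6)

text \<open>The diagonal entries of the image of E_i are the squares of column \<open>i\<close> of
  \<open>A\<close>, so \<open>A\<close> is diagonal with entries 1 or -1. F_12 and F_23 make these
  signs equal. The negative of the identity also acts trivially, and the determinant rules it
  out.\<close>

lemma congruence_trivial_imp_mat1:
  assumes "det A = 1" "\<And>X. X \<in> J3 \<Longrightarrow> A ** X ** transpose A = X"
  shows "A = mat 1"
proof -
  have diag: "A $ j $ i * A $ j $ i = (if i = j then 1 else 0)" for i j
  proof -
    have "(A ** sym_unit i i ** transpose A) $ j $ j = sym_unit i i $ j $ j"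
      using assms(2)[of "sym_unit i i"] by simp
    then show ?thesis
      using exhaust_3[of i] exhaust_3[of j] by (auto simp: mat3_simps sym_unit_nth)
  qed
  have off: "A $ j $ i = 0" if "i \<noteq> j" for i j
    using diag[of j i] that by simp
  have "(A ** sym_unit 1 2 ** transpose A) $ 1 $ 2 = 1"
    "(A ** sym_unit 2 3 ** transpose A) $ 2 $ 3 = 1"
    using assms(2)[of "sym_unit 1 2"] assms(2)[of "sym_unit 2 3"] by (simp_all add: sym_unit_nth)
  then have "A$1$1 * A$2$2 = 1" "A$2$2 * A$3$3 = 1"
    by (simp_all add: mat3_simps sym_unit_nth off)
  moreover have "A$1$1 * A$2$2 * A$3$3 = 1"
    using assms(1) by (simp add: det_3 off)
  ultimately have "A$1$1 = 1" "A$2$2 = 1" "A$3$3 = 1"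
    using diag[of 2 2] by algebra+
  then show ?thesis by (simp add: vec_eq_iff forall_3 off mat_def)
qed

lemma congruence_map_inj: "inj_on congruence_map (carrier SU_1_2)"
proof -
  interpret S: group SU_1_2 by (rule group_SU)
  interpret E: group E6_m14_R by (rule group_E6)
  interpret group_hom SU_1_2 E6_m14_R congruence_map
    by unfold_locales (rule congruence_map_hom)
  have one: "\<one>\<^bsub>SU_1_2\<^esub> = mat 1" by (simp add: SU_1_2_def)
  have "A = mat 1" if A: "A \<in> carrier SU_1_2" "congruence_map A = \<one>\<^bsub>E6_m14_R\<^esub>" for A
  proof (rule congruence_trivial_imp_mat1)
    show "det A = 1" using A by (simp add: SU_1_2_def)
    have eq: "congruence_map A = congruence_map (mat 1)" using A(2) hom_one one by simp
    show "A ** X ** transpose A = X" if "X \<in> J3" for X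
      using fun_cong[OF eq, of X] that by (simp add: congruence_map_def)
  qed
  then show ?thesis by (simp add: inj_on_one_iff one)
qed

lemma congruence_map_surj:
  assumes "\<alpha> \<in> carrier E6_m14_R"
  obtains A where "A \<in> carrier SU_1_2" "congruence_map A = \<alpha>"
proof -
  have \<alpha>: "\<alpha> \<in> extensional J3" "det_preserver \<alpha>"
      "\<And>X Y. X \<in> J3 \<Longrightarrow> Y \<in> J3 \<Longrightarrow> herm_sigma (\<alpha> X) (\<alpha> Y) = herm_sigma X Y"
    using assms by (auto simp: carrier_E6)
  obtain P where P: "det P ^ 2 = 1" "\<And>X. X \<in> J3 \<Longrightarrow> \<alpha> X = P ** X ** transpose P"
    using det_preserver_eq_congruence[OF \<alpha>(2)] by blast
  \<comment> \<open>The scalar \<open>det P\<close> is 1 or -1, so the congruence is unchanged,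
    while the determinant becomes (det P)^3 det P = 1.\<close>
  define A where "A = cscale (det P) P"
  have "det A = det P ^ 2 * det P ^ 2"
    by (simp add: A_def det_cscale power2_eq_square power3_eq_cube)
  then have det: "det A = 1" using P(1) by simp
  have "A ** X ** transpose A = cscale (det P ^ 2) (P ** X ** transpose P)" for X
    by (simp add: A_def mat3_simps power2_eq_square algebra_simps)
  then have A: "\<alpha> X = A ** X ** transpose A" if "X \<in> J3" for X
    using P that by (simp add: cscale_def vec_eq_iff)
  have "A ** I1 ** tau (transpose A) = I1"
    using \<alpha>(3) by (intro congruence_herm_sigma_imp_SU det) (simp add: A)
  then have "A \<in> carrier SU_1_2" using det by (simp add: SU_1_2_def)
  moreover have "congruence_map A = \<alpha>"
    using \<alpha>(1) by (auto simp: congruence_map_def A extensional_def fun_eq_iff)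
  ultimately show ?thesis by (rule that)
qed

theorem theorem3p0p5:
  shows "group E6_m14_R \<and> group SU_1_2 \<and> E6_m14_R \<cong> SU_1_2"
proof -
  have "bij_betw congruence_map (carrier SU_1_2) (carrier E6_m14_R)"
    unfolding bij_betw_def
    using congruence_map_inj congruence_map_E6 congruence_map_surj by blast
  then have "SU_1_2 \<cong> E6_m14_R"
    using congruence_map_hom by (intro is_isoI isoI)
  then show ?thesis
    using group_E6 group_SU group.iso_sym by blast
qed

end
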